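(* Let $L(\lambda)=\lambda M+K\in\mathbb{C}^{n\times n}[\lambda]$ with $M$ Hermitian positive definite and $K$ Hermitian. Let $x_1^c,\dots,x_p^c,x_{p+1}^f,\dots,x_n^f$ be a basis of $\mathbb{C}^n$ of eigenvectors of $L(\lambda)$ with $L(\lambda_i^c)x_i^c=0$ $(1\le i\le p)$ and $L(\lambda_j^f)x_j^f=0$ $(p+1\le j\le n)$, where $(x_i^c)^*Mx_j^c=0$ for $i\ne j$ and $(x_i^c)^*Mx_i^c=1$. Set $X_c=[x_1^c\ \cdots\ x_p^c]$, $X_f=[x_{p+1}^f\ \cdots\ x_n^f]$, $\Lambda_c=\mathrm{diag}(\lambda_i^c)$, $\Lambda_f=\mathrm{diag}(\lambda_j^f)$. Suppose $\{\lambda_1^c,\dots,\lambda_p^c\}\cap\{\lambda_{p+1}^f,\dots,\lambda_n^f\}=\emptyset$ and let $\Lambda_a\in\mathbb{R}^{p\times p}$ be a real diagonal matrix. For arbitrary real diagonal matrices $Z_1,Z_2\in\mathbb{R}^{p\times p}$ put $H_a=(\Lambda_a^2+I_p)^{-1}$ and $$\hat M=H_a\left[(\Lambda_c-\Lambda_a)\Lambda_a+Z_1-Z_2\Lambda_a\right],\qquad \hat K=H_a\left[(\Lambda_c-\Lambda_a)-Z_1\Lambda_a+Z_2\Lambda_a^2\right],$$ $$\Delta M=MX_c\hat MX_c^*M,\qquad \Delta K=MX_c\hat KX_c^*M.$$ Then $\Delta M$ and $\Delta K$ are Hermitian, and $(X_c,\Lambda_a)$ and $(X_f,\Lambda_f)$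 are complementary deflating pairs of $L_\Delta(\lambda)=\lambda(M+\Delta M)+(K+\Delta K)$. Moreover, if $Z_1$ and $Z_2$ are chosen such that $(\Lambda_c-\Lambda_a)\Lambda_a+Z_1-Z_2\Lambda_a$ is a diagonal matrix with non-negative diagonal entries, then $\Delta M$ is positive semi-definite, and hence $M+\Delta M$ is positive definite.
   Context: A deflating pair of a pencil $\lambda M+K\in\mathbb{C}^{n\times n}[\lambda]$ is a matrix pair $(X,\Lambda)\in\mathbb{C}^{n\times p}\times\mathbb{C}^{p\times p}$ with $\operatorname{rank}X=p\le n$ and $MX\Lambda+KX=0$. Two deflating pairs $(X_1,\Lambda_1)$, $(X_2,\Lambda_2)$ are complementary if $[X_1\ X_2]$ is a nonsingular square matrix. $A^*$ is the conjugate transpose of $A$. *)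

theory Defs
  imports
    "Jordan_Normal_Form.DL_Rank"
    "Jordan_Normal_Form.Gauss_Jordan_Elimination"
    "Jordan_Normal_Form.Schur_Decomposition"
begin

definition hermitian_mat :: "nat \<Rightarrow> complex mat \<Rightarrow> bool" where
  "hermitian_mat n A \<longleftrightarrow> A \<in> carrier_mat n n \<and> mat_adjoint A = A"

text \<open>The quadratic form \<open>x\<^sup>* A x\<close> is \<open>(A *\<^sub>v x) \<bullet>c x\<close>, since the conjugation acts on the second
  argument of \<open>\<bullet>c\<close>.  The order on complex numbers is that of \<open>Complex_Order\<close>: \<open>0 < z\<close> and
  \<open>0 \<le> z\<close> include that \<open>z\<close> is real.\<close>

definition pos_def_mat :: "nat \<Rightarrow> complex mat \<Rightarrow> bool" where
  "pos_def_mat n A \<longleftrightarrow> hermitian_mat n A \<and>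
     (\<forall>x \<in> carrier_vec n. x \<noteq> 0\<^sub>v n \<longrightarrow> 0 < (A *\<^sub>v x) \<bullet>c x)"

definition pos_semidef_mat :: "nat \<Rightarrow> complex mat \<Rightarrow> bool" where
  "pos_semidef_mat n A \<longleftrightarrow> hermitian_mat n A \<and>
     (\<forall>x \<in> carrier_vec n. 0 \<le> (A *\<^sub>v x) \<bullet>c x)"

definition real_diag_mat :: "nat \<Rightarrow> complex mat \<Rightarrow> bool" where
  "real_diag_mat p A \<longleftrightarrow>
     A \<in> carrier_mat p p \<and> diagonal_mat A \<and> (\<forall>i<p. A $$ (i, i) \<in> \<real>)"

definition pencil :: "complex mat \<Rightarrow> complex mat \<Rightarrow> complex \<Rightarrow> complex mat" where
  "pencil M K z = z \<cdot>\<^sub>m M + K"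

definition deflating_pair ::
  "nat \<Rightarrow> complex mat \<Rightarrow> complex mat \<Rightarrow> nat \<Rightarrow> complex mat \<times> complex mat \<Rightarrow> bool" where
  "deflating_pair n M K p = (\<lambda>(X, \<Lambda>).
     X \<in> carrier_mat n p \<and> \<Lambda> \<in> carrier_mat p p \<and>
     vec_space.rank n X = p \<and> p \<le> n \<and>
     M * X * \<Lambda> + K * X = 0\<^sub>m n p)"

definition hcat_mat :: "'a mat \<Rightarrow> 'a mat \<Rightarrow> 'a mat" where
  "hcat_mat A B = mat_of_cols (dim_row A) (cols A @ cols B)"

definition complementary ::
  "complex mat \<times> complex mat \<Rightarrow> complex mat \<times> complex mat \<Rightarrow> bool" where
  "complementary P Q \<longleftrightarrow> invertible_mat (hcat_mat (fst P) (fst Q))"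

text \<open>Linear independence is a property of sets in the library, so a family is a basis if it is
  injective and its range is a basis.\<close>

definition basis_family :: "nat \<Rightarrow> (nat \<Rightarrow> complex vec) \<Rightarrow> bool" where
  "basis_family n x \<longleftrightarrow> inj_on x {..<n} \<and>
     vectorspace.basis class_ring (module_vec TYPE(complex) n) (x ` {..<n})"

end

theory Submission
  imports Defs
begin

text \<open>
  Everything rests on the matrix \<open>W = (M X\<^sub>c)\<^sup>* = X\<^sub>c\<^sup>* M\<close>, through which both updates factor:
  \<open>\<Delta>M = M X\<^sub>c Mhat W\<close> and \<open>\<Delta>K = M X\<^sub>c Khat W\<close>.  Orthonormality of the eigenvectors to be
  changed says \<open>W X\<^sub>c = I\<close>.  Since \<open>M\<close> is positive definite, the eigenvalues of the pencil are real
  and eigenvectors for different eigenvalues are \<open>M\<close>-orthogonal; both facts are instances of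
  \<open>hermitian_pencil_eigenvectors\<close>.  As the two spectra are disjoint, \<open>W X\<^sub>f = 0\<close>, so the updates
  vanish on \<open>X\<^sub>f\<close> and the pair \<open>(X\<^sub>f, \<Lambda>\<^sub>f)\<close> survives (\<open>update_keeps_pair\<close>).

  On \<open>X\<^sub>c\<close> one has \<open>K X\<^sub>c = - M X\<^sub>c \<Lambda>\<^sub>c\<close>, and the residual of \<open>(X\<^sub>c, \<Lambda>\<^sub>a)\<close> becomes
  \<open>M X\<^sub>c (\<Lambda>\<^sub>a + Mhat \<Lambda>\<^sub>a + Khat - \<Lambda>\<^sub>c)\<close> (\<open>update_moves_pair\<close>).  It remains to solve
  \<open>Mhat \<Lambda>\<^sub>a + Khat = \<Lambda>\<^sub>c - \<Lambda>\<^sub>a\<close> in diagonal matrices.  With \<open>\<delta> = \<Lambda>\<^sub>c - \<Lambda>\<^sub>a\<close>, the choice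
  \<open>(\<delta> \<Lambda>\<^sub>a, \<delta>)\<close> for \<open>(Mhat, Khat)\<close> gives \<open>\<delta> (\<Lambda>\<^sub>a\<^sup>2 + I)\<close> on the left, which the factor
  \<open>H\<^sub>a = (\<Lambda>\<^sub>a\<^sup>2 + I)\<^sup>-\<^sup>1\<close> normalises, and the parameters \<open>Z\<^sub>1\<close>, \<open>Z\<^sub>2\<close> contribute a multiple of
  \<open>(I, -\<Lambda>\<^sub>a)\<close>, a solution of the homogeneous equation.

  Finally \<open>Mhat\<close> and \<open>Khat\<close> are real diagonal, so the updates are congruences \<open>Y D Y\<^sup>*\<close> with
  \<open>Y = M X\<^sub>c\<close>: they are Hermitian, and positive semidefinite if \<open>D \<ge> 0\<close>
  (\<open>hermitian_congruence\<close>, \<open>pos_semidef_congruence\<close>).  The ranks and the complementarity concern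
  only the matrices \<open>X\<^sub>c\<close>, \<open>X\<^sub>f\<close> and follow from the eigenvectors being a basis.
\<close>

section \<open>Adjoints, sesquilinear forms and diagonal matrices\<close>

lemma mat_adjoint_carrier [simp]:
  "A \<in> carrier_mat m n \<Longrightarrow> mat_adjoint A \<in> carrier_mat n m"
  unfolding mat_adjoint_def by auto

lemma dim_mat_adjoint [simp]:
  "dim_row (mat_adjoint A) = dim_col A" "dim_col (mat_adjoint A) = dim_row A"
  unfolding mat_adjoint_def by auto

lemma index_mat_adjoint:
  assumes "A \<in> carrier_mat m n" "i < n" "j < m"
  shows "mat_adjoint A $$ (i, j) = conjugate (A $$ (j, i))"
  using assms unfolding mat_adjoint_def by (auto simp: mat_of_rows_index)

lemma mat_adjoint_mult:
  fixes A B :: "complex mat"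
  assumes "A \<in> carrier_mat m n" "B \<in> carrier_mat n k"
  shows "mat_adjoint (A * B) = mat_adjoint B * mat_adjoint A"
proof (rule eq_matI)
  fix i j assume "i < dim_row (mat_adjoint B * mat_adjoint A)"
    "j < dim_col (mat_adjoint B * mat_adjoint A)"
  moreover have "mat_adjoint A \<in> carrier_mat n m" "mat_adjoint B \<in> carrier_mat k n"
    using assms by simp_all
  ultimately have ij: "i < k" "j < m" by auto
  have d: "dim_row A = m" "dim_col A = n" "dim_row B = n" "dim_col B = k"
    "dim_row (mat_adjoint A) = n" "dim_col (mat_adjoint A) = m"
    "dim_row (mat_adjoint B) = k" "dim_col (mat_adjoint B) = n"
    using assms by auto
  have "mat_adjoint (A * B) $$ (i, j) = cnj ((A * B) $$ (j, i))"
    using index_mat_adjoint[OF mult_carrier_mat[OF assms] ij] by simp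
  also have "\<dots> = (\<Sum>r<n. cnj (A $$ (j, r)) * cnj (B $$ (r, i)))"
    using ij by (simp add: d scalar_prod_def atLeast0LessThan)
  also have "\<dots> = (mat_adjoint B * mat_adjoint A) $$ (i, j)"
    using ij by (simp add: d scalar_prod_def atLeast0LessThan mult.commute
        index_mat_adjoint[OF assms(1)] index_mat_adjoint[OF assms(2)])
  finally show "mat_adjoint (A * B) $$ (i, j) = (mat_adjoint B * mat_adjoint A) $$ (i, j)" .
qed (use mat_adjoint_carrier[OF assms(1)] mat_adjoint_carrier[OF assms(2)]
      mat_adjoint_carrier[OF mult_carrier_mat[OF assms]] in auto)

lemma mat_adjoint_mat_adjoint:
  fixes A :: "complex mat"
  assumes "A \<in> carrier_mat m n"
  shows "mat_adjoint (mat_adjoint A) = A"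
proof (rule eq_matI)
  have 1: "mat_adjoint A \<in> carrier_mat n m" and 2: "mat_adjoint (mat_adjoint A) \<in> carrier_mat m n"
    using assms by auto
  then show "dim_row (mat_adjoint (mat_adjoint A)) = dim_row A"
    "dim_col (mat_adjoint (mat_adjoint A)) = dim_col A" using assms by auto
  fix i j assume "i < dim_row A" "j < dim_col A"
  then show "mat_adjoint (mat_adjoint A) $$ (i, j) = A $$ (i, j)"
    using assms by (simp add: index_mat_adjoint[OF 1] index_mat_adjoint[OF assms])
qed

lemma mult_mat_vec_cscalar_prod:
  fixes A :: "complex mat"
  assumes A: "A \<in> carrier_mat m n" and u: "u \<in> carrier_vec n" and v: "v \<in> carrier_vec m"
  shows "(A *\<^sub>v u) \<bullet>c v = u \<bullet>c (mat_adjoint A *\<^sub>v v)"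
proof -
  have "(A *\<^sub>v u) \<bullet>c v = (\<Sum>i<m. \<Sum>j<n. A $$ (i, j) * u $ j * cnj (v $ i))"
    using A u v by (simp add: scalar_prod_def atLeast0LessThan sum_distrib_right)
  also have "\<dots> = (\<Sum>j<n. \<Sum>i<m. A $$ (i, j) * u $ j * cnj (v $ i))"
    by (rule sum.swap)
  also have "\<dots> = u \<bullet>c (mat_adjoint A *\<^sub>v v)"
    using A u v by (simp add: scalar_prod_def atLeast0LessThan sum_distrib_left
        index_mat_adjoint[OF A] mult_ac)
  finally show ?thesis .
qed

lemma hermitian_cscalar_prod:
  assumes "hermitian_mat n A" "u \<in> carrier_vec n" "v \<in> carrier_vec n"
  shows "(A *\<^sub>v u) \<bullet>c v = u \<bullet>c (A *\<^sub>v v)"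
  using mult_mat_vec_cscalar_prod[of A n n u v] assms by (auto simp: hermitian_mat_def)

text \<open>The conjugation of \<open>\<bullet>c\<close> acts on its second argument, so the entry \<open>x\<^sub>i\<^sup>* M y\<^sub>j\<close> of the
  generalised Gram matrix appears with its two vectors in reversed order.\<close>

lemma index_mat_adjoint_mult_mult:
  fixes M :: "complex mat"
  assumes M: "M \<in> carrier_mat n n" and X: "X \<in> carrier_mat n p" and Y: "Y \<in> carrier_mat n q"
    and ij: "i < p" "j < q"
  shows "(mat_adjoint X * M * Y) $$ (i, j) = (M *\<^sub>v col Y j) \<bullet>c col X i"
proof -
  have adj: "mat_adjoint X \<in> carrier_mat p n" using X by simp
  have "row (mat_adjoint X) i = conjugate (col X i)"
    using X adj ij by (intro eq_vecI) (auto simp: index_mat_adjoint[OF X])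
  moreover have "mat_adjoint X * M * Y = mat_adjoint X * (M * Y)"
    using adj M Y by (rule assoc_mult_mat)
  moreover have "col (M * Y) j = M *\<^sub>v col Y j"
    using M Y ij by (intro col_mult2) auto
  moreover have "conjugate (col X i) \<bullet> (M *\<^sub>v col Y j) = (M *\<^sub>v col Y j) \<bullet>c col X i"
    using M X Y by (intro comm_scalar_prod[of _ n]) auto
  ultimately show ?thesis
    using index_mult_mat(1)[of i "mat_adjoint X" j "M * Y"] X Y ij by simp
qed

lemma real_diag_mat_iff:
  "real_diag_mat p A \<longleftrightarrow> (\<exists>a. (\<forall>i<p. a i \<in> \<real>) \<and> A = mat_diag p a)"
proof
  assume A: "real_diag_mat p A"
  define a where "a = (\<lambda>i. A $$ (i, i))"
  have "A = mat_diag p a"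
    using A by (intro eq_matI) (auto simp: real_diag_mat_def mat_diag_def diagonal_mat_def a_def)
  moreover have "\<forall>i<p. a i \<in> \<real>" using A by (simp add: real_diag_mat_def a_def)
  ultimately show "\<exists>a. (\<forall>i<p. a i \<in> \<real>) \<and> A = mat_diag p a" by blast
qed (auto simp: real_diag_mat_def mat_diag_def diagonal_mat_def)

lemma mat_diag_add: "mat_diag n f + mat_diag n g = mat_diag n (\<lambda>i. f i + g i :: 'a :: monoid_add)"
  by (auto simp: mat_diag_def)

lemma mat_diag_minus: "mat_diag n f - mat_diag n g = mat_diag n (\<lambda>i. f i - g i :: 'a :: group_add)"
  by (auto simp: mat_diag_def)

lemma mat_diag_square:
  fixes f :: "nat \<Rightarrow> 'a :: semiring_1"
  shows "mat_diag n f ^\<^sub>m 2 = mat_diag n (\<lambda>i. f i * f i)"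
proof -
  have "dim_row (mat_diag n f) = n" by (simp add: mat_diag_def)
  then show ?thesis using left_mult_one_mat[OF mat_diag_dim[of n f]] by (simp add: numeral_2_eq_2)
qed

lemma mat_diag_cong: "(\<And>i. i < n \<Longrightarrow> f i = g i) \<Longrightarrow> mat_diag n f = mat_diag n g"
  by (auto simp: mat_diag_def)

text \<open>Inverses are unique, so the inverse that Gauss-Jordan elimination finds is the one at hand.\<close>

lemma mat_inverse_eqI:
  fixes A B :: "'a :: field mat"
  assumes A: "A \<in> carrier_mat n n" and B: "B \<in> carrier_mat n n"
    and AB: "A * B = 1\<^sub>m n" and BA: "B * A = 1\<^sub>m n"
  shows "mat_inverse A = Some B"
proof (cases "mat_inverse A")
  case None
  have "A \<in> Units (ring_mat TYPE('a) n undefined)"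
    using assms by (auto simp: Units_def ring_mat_def)
  with mat_inverse(1)[OF A None, of undefined] show ?thesis by blast
next
  case (Some C)
  have C: "C * A = 1\<^sub>m n" "C \<in> carrier_mat n n" using mat_inverse(2)[OF A Some] by auto
  have "C = C * (A * B)" using AB C by simp
  also have "\<dots> = C * A * B" using A B C by (intro assoc_mult_mat[symmetric])
  also have "\<dots> = B" using B C by simp
  finally show ?thesis using Some by simp
qed

lemma mat_inverse_mat_diag:
  fixes f :: "nat \<Rightarrow> 'a :: field"
  assumes "\<And>i. i < n \<Longrightarrow> f i \<noteq> 0"
  shows "mat_inverse (mat_diag n f) = Some (mat_diag n (\<lambda>i. inverse (f i)))"
  by (rule mat_inverse_eqI[of _ n])
    (use assms in \<open>auto simp flip: mat_diag_one intro!: mat_diag_cong\<close>)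

section \<open>Hermitian congruences\<close>

lemma hermitian_congruence:
  assumes Y: "Y \<in> carrier_mat n p" and d: "\<And>i. i < p \<Longrightarrow> d i \<in> \<real>"
  shows "hermitian_mat n (Y * mat_diag p d * mat_adjoint Y)"
proof -
  have adj: "mat_adjoint Y \<in> carrier_mat p n" using Y by simp
  have D: "mat_diag p d \<in> carrier_mat p p" by simp
  have "mat_adjoint (mat_diag p d) = mat_diag p d"
  proof (rule eq_matI)
    fix i j assume "i < dim_row (mat_diag p d)" "j < dim_col (mat_diag p d)"
    then show "mat_adjoint (mat_diag p d) $$ (i, j) = mat_diag p d $$ (i, j)"
      using d index_mat_adjoint[OF D, of i j] by (auto simp: mat_diag_def Reals_cnj_iff)
  qed (auto simp: mat_diag_def)
  moreover have "Y * mat_diag p d * mat_adjoint Y = Y * (mat_diag p d * mat_adjoint Y)"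
    using Y D adj by (rule assoc_mult_mat)
  ultimately have "mat_adjoint (Y * mat_diag p d * mat_adjoint Y)
      = Y * mat_diag p d * mat_adjoint Y"
    using mat_adjoint_mult[OF mult_carrier_mat[OF Y D] adj] mat_adjoint_mult[OF Y D]
      mat_adjoint_mat_adjoint[OF Y] by metis
  then show ?thesis using mult_carrier_mat[OF mult_carrier_mat[OF Y D] adj]
    by (simp only: hermitian_mat_def)
qed

text \<open>With \<open>w = Y\<^sup>* x\<close> the quadratic form \<open>x\<^sup>* Y D Y\<^sup>* x\<close> is the weighted sum of squares
  \<open>\<Sum>i. d\<^sub>i \<bar>w\<^sub>i\<bar>\<^sup>2\<close>.\<close>

lemma pos_semidef_congruence:
  assumes Y: "Y \<in> carrier_mat n p" and d: "\<And>i. i < p \<Longrightarrow> 0 \<le> d i"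
  shows "pos_semidef_mat n (Y * mat_diag p d * mat_adjoint Y)"
  unfolding pos_semidef_mat_def
proof (intro conjI ballI)
  show "hermitian_mat n (Y * mat_diag p d * mat_adjoint Y)"
    using d by (intro hermitian_congruence[OF Y]) (auto simp: less_eq_complex_def complex_is_Real_iff)
  fix x :: "complex vec" assume x: "x \<in> carrier_vec n"
  have adj: "mat_adjoint Y \<in> carrier_mat p n" using Y by simp
  have D: "mat_diag p d \<in> carrier_mat p p" by simp
  define w where "w = mat_adjoint Y *\<^sub>v x"
  have w: "w \<in> carrier_vec p" using adj x by (simp add: w_def)
  have "Y * mat_diag p d * mat_adjoint Y *\<^sub>v x = Y *\<^sub>v (mat_diag p d *\<^sub>v w)"
    using assoc_mult_mat_vec[OF mult_carrier_mat[OF Y D] adj x] assoc_mult_mat_vec[OF Y D w]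
    by (simp add: w_def)
  then have "(Y * mat_diag p d * mat_adjoint Y *\<^sub>v x) \<bullet>c x = (mat_diag p d *\<^sub>v w) \<bullet>c w"
    using mult_mat_vec_cscalar_prod[OF Y mult_mat_vec_carrier[OF D w] x] by (simp add: w_def)
  also have "\<dots> = (\<Sum>i<p. d i * (w $ i * cnj (w $ i)))"
  proof -
    have "(mat_diag p d *\<^sub>v w) $ i = d i * w $ i" if "i < p" for i
      using that w by (simp add: mat_diag_def scalar_prod_def if_distrib[of "\<lambda>t. t * _"] cong: if_cong)
    then show ?thesis
      using w by (simp add: scalar_prod_def atLeast0LessThan mult_ac)
  qed
  also have "0 \<le> \<dots>"
    using d conjugate_square_positive[where 'a = complex]
    by (intro sum_nonneg) (auto intro: mult_nonneg_nonneg)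
  finally show "0 \<le> (Y * mat_diag p d * mat_adjoint Y *\<^sub>v x) \<bullet>c x" .
qed

lemma pos_def_add_pos_semidef:
  assumes A: "pos_def_mat n A" and B: "pos_semidef_mat n B"
  shows "pos_def_mat n (A + B)"
proof -
  have hA: "hermitian_mat n A" and hB: "hermitian_mat n B"
    and cA: "A \<in> carrier_mat n n" and cB: "B \<in> carrier_mat n n"
    using A B by (auto simp: pos_def_mat_def pos_semidef_mat_def hermitian_mat_def)
  have "mat_adjoint (A + B) = A + B"
  proof (rule eq_matI)
    have AB: "A + B \<in> carrier_mat n n" using cA cB by simp
    show "dim_row (mat_adjoint (A + B)) = dim_row (A + B)"
      "dim_col (mat_adjoint (A + B)) = dim_col (A + B)"
      using cA cB by auto
    fix i j assume "i < dim_row (A + B)" "j < dim_col (A + B)"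
    then have ij: "i < n" "j < n" using AB by auto
    have "A $$ (i, j) = cnj (A $$ (j, i))" "B $$ (i, j) = cnj (B $$ (j, i))"
      using index_mat_adjoint[OF cA ij] index_mat_adjoint[OF cB ij] hA hB
      by (auto simp: hermitian_mat_def)
    then show "mat_adjoint (A + B) $$ (i, j) = (A + B) $$ (i, j)"
      using index_mat_adjoint[OF AB ij] cA cB ij by simp
  qed
  moreover have "0 < ((A + B) *\<^sub>v x) \<bullet>c x" if "x \<in> carrier_vec n" "x \<noteq> 0\<^sub>v n" for x
  proof -
    have "((A + B) *\<^sub>v x) \<bullet>c x = (A *\<^sub>v x) \<bullet>c x + (B *\<^sub>v x) \<bullet>c x"
      using cA cB that add_scalar_prod_distrib[of "A *\<^sub>v x" n "B *\<^sub>v x" "conjugate x"]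
      by (simp add: add_mult_distrib_mat_vec[OF cA cB])
    then show ?thesis using A B that
      by (simp add: pos_def_mat_def pos_semidef_mat_def add_pos_nonneg)
  qed
  ultimately show ?thesis using cA cB by (simp add: pos_def_mat_def hermitian_mat_def)
qed

section \<open>Eigenvectors of a Hermitian pencil\<close>

lemma pencil_mult_vec:
  assumes M: "M \<in> carrier_mat n n" and K: "K \<in> carrier_mat n n" and v: "v \<in> carrier_vec n"
  shows "pencil M K c *\<^sub>v v = c \<cdot>\<^sub>v (M *\<^sub>v v) + K *\<^sub>v v"
proof -
  have "(c \<cdot>\<^sub>m M) *\<^sub>v v = c \<cdot>\<^sub>v (M *\<^sub>v v)" using M v by (intro eq_vecI) auto
  then show ?thesis using add_mult_distrib_mat_vec[of "c \<cdot>\<^sub>m M" n n K v] assms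
    by (simp add: pencil_def)
qed

text \<open>The sesquilinear forms of \<open>M\<close> and \<open>K\<close> are both Hermitian, so \<open>v\<^sup>* K u\<close> can be evaluated by
  the eigenvalue equation on either side, as \<open>- a v\<^sup>* M u\<close> and as \<open>- cnj b v\<^sup>* M u\<close>.  For \<open>u = v\<close>
  and \<open>a = b\<close> this makes the eigenvalue real as soon as \<open>u\<^sup>* M u\<close> does not vanish; for different
  real eigenvalues it gives orthogonality with respect to \<open>M\<close>.\<close>

lemma hermitian_pencil_eigenvectors:
  assumes M: "hermitian_mat n M" and K: "hermitian_mat n K"
    and u: "u \<in> carrier_vec n" and v: "v \<in> carrier_vec n"
    and eu: "pencil M K a *\<^sub>v u = 0\<^sub>v n" and ev: "pencil M K b *\<^sub>v v = 0\<^sub>v n"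
  shows "(a - cnj b) * ((M *\<^sub>v u) \<bullet>c v) = 0"
proof -
  have cM: "M \<in> carrier_mat n n" and cK: "K \<in> carrier_mat n n"
    using M K by (auto simp: hermitian_mat_def)
  have split: "c * ((M *\<^sub>v y) \<bullet>c z) + (K *\<^sub>v y) \<bullet>c z = 0"
    if "y \<in> carrier_vec n" "z \<in> carrier_vec n" "pencil M K c *\<^sub>v y = 0\<^sub>v n" for c y z
  proof -
    have "(c \<cdot>\<^sub>v (M *\<^sub>v y) + K *\<^sub>v y) \<bullet>c z = 0"
      unfolding pencil_mult_vec[OF cM cK that(1), of c, symmetric] that(3) using that(2) by simp
    then show ?thesis using cM cK that
      by (simp add: add_scalar_prod_distrib[of _ n])
  qed
  have flip: "cnj ((A *\<^sub>v v) \<bullet>c u) = (A *\<^sub>v u) \<bullet>c v" if "hermitian_mat n A" for A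
  proof -
    have "cnj (w \<bullet>c u) = u \<bullet>c w" if "w \<in> carrier_vec n" for w
      using that u by (simp add: scalar_prod_def mult.commute)
    moreover have "A *\<^sub>v v \<in> carrier_vec n" using that v by (auto simp: hermitian_mat_def)
    ultimately have "cnj ((A *\<^sub>v v) \<bullet>c u) = u \<bullet>c (A *\<^sub>v v)" by blast
    then show ?thesis using hermitian_cscalar_prod[OF that u v] by simp
  qed
  have "cnj (b * ((M *\<^sub>v v) \<bullet>c u) + (K *\<^sub>v v) \<bullet>c u) = 0"
    using split[OF v u ev] by simp
  then have "cnj b * ((M *\<^sub>v u) \<bullet>c v) + (K *\<^sub>v u) \<bullet>c v = 0"
    using flip[OF M] flip[OF K] by simp
  then have "a * ((M *\<^sub>v u) \<bullet>c v) = cnj b * ((M *\<^sub>v u) \<bullet>c v)"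
    using split[OF u v eu] by (metis add_right_cancel)
  then show ?thesis by (simp add: left_diff_distrib)
qed

lemma pencil_eigenvector_matrix:
  assumes M: "M \<in> carrier_mat n n" and K: "K \<in> carrier_mat n n" and X: "X \<in> carrier_mat n p"
    and eig: "\<And>i. i < p \<Longrightarrow> pencil M K (l i) *\<^sub>v col X i = 0\<^sub>v n"
  shows "M * X * mat_diag p l + K * X = 0\<^sub>m n p"
proof (rule eq_matI)
  fix i j assume "i < dim_row (0\<^sub>m n p :: complex mat)" "j < dim_col (0\<^sub>m n p :: complex mat)"
  then have ij: "i < n" "j < p" by auto
  have "(M * X * mat_diag p l + K * X) $$ (i, j) = l j * (row M i \<bullet> col X j) + row K i \<bullet> col X j"
    using M K X ij by (simp add: mat_diag_mult_right[of _ n])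
  also have "\<dots> = (pencil M K (l j) *\<^sub>v col X j) $ i"
    using pencil_mult_vec[OF M K, of "col X j" "l j"] M K X ij by simp
  also have "\<dots> = 0" using eig ij by simp
  finally show "(M * X * mat_diag p l + K * X) $$ (i, j) = 0\<^sub>m n p $$ (i, j)" using ij by simp
qed (use M K X in \<open>auto simp: mat_diag_def\<close>)

section \<open>Low-rank updates of a pencil\<close>

text \<open>The left inverse \<open>W\<close> turns the action of the updates on \<open>X\<close> into right multiplication of
  \<open>M X\<close> by \<open>A\<close> and \<open>B\<close>, so that the eigenvalue equation is moved from \<open>\<Lambda>\<close> to \<open>\<Lambda>'\<close> by an equation
  between the small matrices alone.\<close>

lemma update_moves_pair:
  fixes M K :: "complex mat"
  assumes M: "M \<in> carrier_mat n n" and K: "K \<in> carrier_mat n n" and X: "X \<in> carrier_mat n p"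
    and W: "W \<in> carrier_mat p n" and A: "A \<in> carrier_mat p p" and B: "B \<in> carrier_mat p p"
    and \<Lambda>: "\<Lambda> \<in> carrier_mat p p" and \<Lambda>': "\<Lambda>' \<in> carrier_mat p p"
    and WX: "W * X = 1\<^sub>m p"
    and pair: "M * X * \<Lambda> + K * X = 0\<^sub>m n p"
    and shift: "\<Lambda>' + A * \<Lambda>' + B = \<Lambda>"
  shows "(M + M * X * A * W) * X * \<Lambda>' + (K + M * X * B * W) * X = 0\<^sub>m n p"
proof -
  have Y: "M * X \<in> carrier_mat n p" using M X by simp
  have upd: "M * X * C * W * X = M * X * C" if C: "C \<in> carrier_mat p p" for C
    using assoc_mult_mat[OF mult_carrier_mat[OF Y C] W X] WX Y C by simp
  have "(M + M * X * A * W) * X = M * X + M * X * A"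
    using M X W A Y upd[OF A] by (subst add_mult_distrib_mat[of _ n n]) auto
  then have 1: "(M + M * X * A * W) * X * \<Lambda>' = M * X * \<Lambda>' + M * X * (A * \<Lambda>')"
    using Y A \<Lambda>' by (simp add: add_mult_distrib_mat[of _ n p] assoc_mult_mat[of _ n p])
  have 2: "(K + M * X * B * W) * X = K * X + M * X * B"
    using K X W B Y upd[OF B] by (subst add_mult_distrib_mat[of _ n n]) auto
  have 3: "M * X * \<Lambda> = M * X * \<Lambda>' + M * X * (A * \<Lambda>') + M * X * B"
    unfolding shift[symmetric] using Y A B \<Lambda>' mult_carrier_mat[OF A \<Lambda>']
      mult_add_distrib_mat[OF Y add_carrier_mat[OF mult_carrier_mat[OF A \<Lambda>']] B]
      mult_add_distrib_mat[OF Y \<Lambda>' mult_carrier_mat[OF A \<Lambda>']]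
    by metis
  have "P + Q + (R + S) = P + Q + S + R"
    if "P \<in> carrier_mat n p" "Q \<in> carrier_mat n p" "R \<in> carrier_mat n p" "S \<in> carrier_mat n p"
    for P Q R S :: "complex mat"
    using that by (intro eq_matI) auto
  then have "(M + M * X * A * W) * X * \<Lambda>' + (K + M * X * B * W) * X = M * X * \<Lambda> + K * X"
    unfolding 1 2 3 using Y A B \<Lambda>' K X by (metis mult_carrier_mat)
  then show ?thesis using pair by simp
qed

text \<open>There is no spill-over: since \<open>W\<close> annihilates \<open>X\<close>, the old and the new pencil have the same
  coefficients on the columns of \<open>X\<close>.\<close>

lemma update_keeps_pair:
  fixes M K :: "complex mat"
  assumes M: "M \<in> carrier_mat n n" and K: "K \<in> carrier_mat n n" and X: "X \<in> carrier_mat n q"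
    and W: "W \<in> carrier_mat p n" and A: "A \<in> carrier_mat n p" and B: "B \<in> carrier_mat n p"
    and WX: "W * X = 0\<^sub>m p q"
    and pair: "M * X * \<Lambda> + K * X = 0\<^sub>m n q"
  shows "(M + A * W) * X * \<Lambda> + (K + B * W) * X = 0\<^sub>m n q"
proof -
  have "(N + C * W) * X = N * X" if "N \<in> carrier_mat n n" "C \<in> carrier_mat n p" for N C
    using that X W WX
    by (simp add: add_mult_distrib_mat[of _ n n] assoc_mult_mat[of _ n p])
  then show ?thesis using assms by simp
qed

section \<open>Ranks of subfamilies of a basis\<close>

lemma basis_family_carrier:
  assumes "basis_family n x" "i < n"
  shows "x i \<in> carrier_vec n"
proof -
  interpret vec_space "TYPE(complex)" n .
  have "x ` {..<n} \<subseteq> carrier_vec n" using assms(1) basis_def by (auto simp: basis_family_def)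
  then show ?thesis using assms(2) by blast
qed

lemma basis_family_nonzero:
  assumes "basis_family n x" "i < n"
  shows "x i \<noteq> 0\<^sub>v n"
proof
  interpret vec_space "TYPE(complex)" n .
  assume "x i = 0\<^sub>v n"
  then have "0\<^sub>v n \<in> x ` {..<n}" using assms(2) by (metis imageI lessThan_iff)
  moreover have "lin_indpt (x ` {..<n})" using assms(1) basis_def by (auto simp: basis_family_def)
  moreover have "x ` {..<n} \<subseteq> carrier_vec n" using basis_family_carrier[OF assms(1)] by auto
  ultimately show False using vs_zero_lin_dep[of "x ` {..<n}"] by simp
qed

lemma rank_mat_of_cols_basis_family:
  assumes x: "basis_family n x" and "distinct is" "set is \<subseteq> {..<n}"
  shows "vec_space.rank n (mat_of_cols n (map x is)) = length is"
proof -
  interpret vec_space "TYPE(complex)" n .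
  have cols: "cols (mat_of_cols n (map x is)) = map x is"
    using basis_family_carrier[OF x] assms(3) by (intro cols_mat_of_cols) auto
  have "lin_indpt (x ` {..<n})" using x basis_def by (auto simp: basis_family_def)
  then have "lin_indpt (x ` set is)" using assms(3) by (meson image_mono subset_li_is_li)
  moreover have "distinct (map x is)"
    using assms by (auto simp: distinct_map basis_family_def intro: inj_on_subset)
  ultimately show ?thesis
    by (intro lin_indpt_full_rank) (auto simp: cols)
qed

lemma full_rank_invertible:
  fixes A :: "complex mat"
  assumes A: "A \<in> carrier_mat n n" and "vec_space.rank n A = n"
  shows "invertible_mat A"
proof -
  have "det A \<noteq> 0" using assms vec_space.det_rank_iff[of A n] by simp
  from det_non_zero_imp_unit[OF A this]
  obtain B where "B \<in> carrier_mat n n" "A * B = 1\<^sub>m n" "B * A = 1\<^sub>m n"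
    by (auto simp: Units_def ring_mat_def)
  then show ?thesis using A by (auto simp: invertible_mat_def inverts_mat_def)
qed

section \<open>Eigenvalue assignment without spill-over\<close>

theorem mainTheorem5:
  fixes n p :: nat
    and M K :: "complex mat"
    and x :: "nat \<Rightarrow> complex vec" and l :: "nat \<Rightarrow> complex"
    and Xc Xf \<Lambda>c \<Lambda>f \<Lambda>a Z1 Z2 Ha Mhat Khat \<Delta>M \<Delta>K :: "complex mat"
  assumes M: "pos_def_mat n M"
    and K: "hermitian_mat n K"
    and p: "p \<le> n"
    and basis: "basis_family n x"
    and eig: "\<And>i. i < n \<Longrightarrow> pencil M K (l i) *\<^sub>v x i = 0\<^sub>v n"
    and orth: "\<And>i j. i < p \<Longrightarrow> j < p \<Longrightarrow> i \<noteq> j \<Longrightarrow> (M *\<^sub>v x j) \<bullet>c x i = 0"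
    and normal: "\<And>i. i < p \<Longrightarrow> (M *\<^sub>v x i) \<bullet>c x i = 1"
    and Xc: "Xc = mat_of_cols n (map x [0..<p])"
    and Xf: "Xf = mat_of_cols n (map x [p..<n])"
    and \<Lambda>c: "\<Lambda>c = mat_diag p l"
    and \<Lambda>f: "\<Lambda>f = mat_diag (n - p) (\<lambda>j. l (p + j))"
    and disjoint: "l ` {..<p} \<inter> l ` {p..<n} = {}"
    and \<Lambda>a: "real_diag_mat p \<Lambda>a"
    and Z1: "real_diag_mat p Z1"
    and Z2: "real_diag_mat p Z2"
    and Ha: "Ha = the (mat_inverse (\<Lambda>a ^\<^sub>m 2 + 1\<^sub>m p))"
    and Mhat: "Mhat = Ha * ((\<Lambda>c - \<Lambda>a) * \<Lambda>a + Z1 - Z2 * \<Lambda>a)"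
    and Khat: "Khat = Ha * ((\<Lambda>c - \<Lambda>a) - Z1 * \<Lambda>a + Z2 * \<Lambda>a ^\<^sub>m 2)"
    and \<Delta>M: "\<Delta>M = M * Xc * Mhat * mat_adjoint Xc * M"
    and \<Delta>K: "\<Delta>K = M * Xc * Khat * mat_adjoint Xc * M"
  shows "hermitian_mat n \<Delta>M \<and> hermitian_mat n \<Delta>K \<and>
    deflating_pair n (M + \<Delta>M) (K + \<Delta>K) p (Xc, \<Lambda>a) \<and>
    deflating_pair n (M + \<Delta>M) (K + \<Delta>K) (n - p) (Xf, \<Lambda>f) \<and>
    complementary (Xc, \<Lambda>a) (Xf, \<Lambda>f) \<and>
    (let D = (\<Lambda>c - \<Lambda>a) * \<Lambda>a + Z1 - Z2 * \<Lambda>a in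
       diagonal_mat D \<and> (\<forall>i<p. 0 \<le> D $$ (i, i)) \<longrightarrow>
       pos_semidef_mat n \<Delta>M \<and> pos_def_mat n (M + \<Delta>M))"
proof -
  have hM: "hermitian_mat n M" and cM: "M \<in> carrier_mat n n" and cK: "K \<in> carrier_mat n n"
    using M K by (auto simp: pos_def_mat_def hermitian_mat_def)
  obtain a where a: "\<And>i. i < p \<Longrightarrow> a i \<in> \<real>" "\<Lambda>a = mat_diag p a"
    using \<Lambda>a real_diag_mat_iff by blast
  obtain z1 where z1: "\<And>i. i < p \<Longrightarrow> z1 i \<in> \<real>" "Z1 = mat_diag p z1"
    using Z1 real_diag_mat_iff by blast
  obtain z2 where z2: "\<And>i. i < p \<Longrightarrow> z2 i \<in> \<real>" "Z2 = mat_diag p z2"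
    using Z2 real_diag_mat_iff by blast
  note xc = basis_family_carrier[OF basis]
  have cXc: "Xc \<in> carrier_mat n p" and cXf: "Xf \<in> carrier_mat n (n - p)"
    by (auto simp: Xc Xf mat_of_cols_def)
  have colc: "col Xc i = x i" if "i < p" for i using that p xc by (simp add: Xc)
  have colf: "col Xf j = x (p + j)" if "j < n - p" for j using that p xc by (simp add: Xf)
  have cXc': "mat_adjoint Xc \<in> carrier_mat p n" using cXc by simp

  have l_real: "l i \<in> \<real>" if "i < n" for i
  proof -
    have "0 < (M *\<^sub>v x i) \<bullet>c x i"
      using M xc[OF that] basis_family_nonzero[OF basis that] by (simp add: pos_def_mat_def)
    then have "l i - cnj (l i) = 0"
      using hermitian_pencil_eigenvectors[OF hM K xc[OF that] xc[OF that] eig[OF that] eig[OF that]]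
      by auto
    then show ?thesis by (simp add: Reals_cnj_iff)
  qed

  \<comment> \<open>All small matrices are diagonal; from here on they are replaced by their diagonals.\<close>
  define h where "h = (\<lambda>i. inverse (a i * a i + 1))"
  define d where "d = (\<lambda>i. (l i - a i) * a i + z1 i - z2 i * a i)"
  define m where "m = (\<lambda>i. h i * d i)"
  define k where "k = (\<lambda>i. h i * ((l i - a i) - z1 i * a i + z2 i * (a i * a i)))"
  have a_pos: "0 < a i * a i + 1" if i: "i < p" for i
  proof -
    obtain r where "a i = complex_of_real r" using a(1)[OF i] by (auto elim: Reals_cases)
    then have "a i * a i + 1 = complex_of_real (r * r + 1)" by simp
    moreover have "0 < r * r + 1" by (simp add: add_nonneg_pos)
    ultimately show ?thesis by (simp only: less_complex_def) simp
  qed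
  have \<Lambda>sq: "\<Lambda>a ^\<^sub>m 2 = mat_diag p (\<lambda>i. a i * a i)" by (simp add: a(2) mat_diag_square)
  have "\<Lambda>a ^\<^sub>m 2 + 1\<^sub>m p = mat_diag p (\<lambda>i. a i * a i + 1)"
    by (simp add: \<Lambda>sq mat_diag_add flip: mat_diag_one)
  then have Ha': "Ha = mat_diag p h"
    unfolding Ha h_def using a_pos mat_inverse_mat_diag[of p "\<lambda>i. a i * a i + 1"] by fastforce
  have D: "(\<Lambda>c - \<Lambda>a) * \<Lambda>a + Z1 - Z2 * \<Lambda>a = mat_diag p d"
    by (simp add: \<Lambda>c a(2) z1(2) z2(2) mat_diag_add mat_diag_minus d_def)
  have Mh: "Mhat = mat_diag p m" by (simp add: Mhat D Ha' m_def)
  have Kh: "Khat = mat_diag p k"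
    unfolding Khat \<Lambda>sq by (simp add: Ha' \<Lambda>c a(2) z1(2) z2(2) mat_diag_add mat_diag_minus k_def)
  have m_real: "m i \<in> \<real>" and k_real: "k i \<in> \<real>" if "i < p" for i
    using a(1)[OF that] z1(1)[OF that] z2(1)[OF that] l_real[of i] that p
    by (auto simp: m_def k_def h_def d_def intro!: Reals_add Reals_diff Reals_mult Reals_inverse)
  have shift: "\<Lambda>a + Mhat * \<Lambda>a + Khat = \<Lambda>c"
  proof -
    have "a i + m i * a i + k i = l i" if "i < p" for i
    proof -
      \<comment> \<open>The contributions of \<open>z1\<close> and \<open>z2\<close> cancel.\<close>
      have "m i * a i + k i = h i * ((a i * a i + 1) * (l i - a i))"
        by (simp add: m_def k_def d_def algebra_simps)
      also have "\<dots> = l i - a i" using a_pos[OF that] by (simp add: h_def)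
      finally show ?thesis by (simp add: algebra_simps)
    qed
    then show ?thesis by (simp add: a(2) Mh Kh \<Lambda>c mat_diag_add cong: mat_diag_cong)
  qed

  \<comment> \<open>Hermiticity of \<open>M\<close> brings both updates into the form of a congruence by \<open>M * Xc\<close>.\<close>
  have "mat_adjoint Xc * M = mat_adjoint (M * Xc)"
    using mat_adjoint_mult[OF cM cXc] hM by (simp add: hermitian_mat_def)
  moreover have "M * Xc * C * mat_adjoint Xc * M = M * Xc * C * (mat_adjoint Xc * M)"
    if "C \<in> carrier_mat p p" for C
    using that cM cXc cXc' by (intro assoc_mult_mat[of _ n p _ n]) auto
  ultimately have \<Delta>M': "\<Delta>M = M * Xc * mat_diag p m * mat_adjoint (M * Xc)"
    and \<Delta>K': "\<Delta>K = M * Xc * mat_diag p k * mat_adjoint (M * Xc)"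
    and W: "mat_adjoint (M * Xc) = mat_adjoint Xc * M"
    by (simp_all add: \<Delta>M \<Delta>K Mh Kh)
  have cY: "M * Xc \<in> carrier_mat n p" using cM cXc by simp
  have cW: "mat_adjoint (M * Xc) \<in> carrier_mat p n" using cY by simp

  have Wc: "mat_adjoint (M * Xc) * Xc = 1\<^sub>m p"
  proof (rule eq_matI)
    fix i j assume "i < dim_row (1\<^sub>m p :: complex mat)" "j < dim_col (1\<^sub>m p :: complex mat)"
    then show "(mat_adjoint (M * Xc) * Xc) $$ (i, j) = 1\<^sub>m p $$ (i, j)"
      unfolding W using orth normal
      by (auto simp: index_mat_adjoint_mult_mult[OF cM cXc cXc] colc)
  qed (use cW cXc in auto)
  have Wf: "mat_adjoint (M * Xc) * Xf = 0\<^sub>m p (n - p)"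
  proof (rule eq_matI)
    fix i j assume "i < dim_row (0\<^sub>m p (n - p) :: complex mat)"
      "j < dim_col (0\<^sub>m p (n - p) :: complex mat)"
    then have ij: "i < p" "j < n - p" and ij': "i < n" "p + j < n" using p by auto
    have "l (p + j) \<noteq> l i" using disjoint ij by fastforce
    then have "(M *\<^sub>v x (p + j)) \<bullet>c x i = 0"
      using hermitian_pencil_eigenvectors[OF hM K xc xc eig eig, OF ij'(2,1) ij'(2,1)]
        l_real[OF ij'(1)] by (simp add: Reals_cnj_iff)
    then show "(mat_adjoint (M * Xc) * Xf) $$ (i, j) = 0\<^sub>m p (n - p) $$ (i, j)"
      unfolding W using ij by (simp add: index_mat_adjoint_mult_mult[OF cM cXc cXf] colc colf)
  qed (use cW cXf in auto)

  have "M * Xc * \<Lambda>c + K * Xc = 0\<^sub>m n p"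
    unfolding \<Lambda>c using eig p colc by (intro pencil_eigenvector_matrix[OF cM cK cXc]) auto
  then have eqc: "(M + \<Delta>M) * Xc * \<Lambda>a + (K + \<Delta>K) * Xc = 0\<^sub>m n p"
    unfolding \<Delta>M' \<Delta>K' using shift
    by (intro update_moves_pair[OF cM cK cXc cW _ _ _ _ Wc]) (auto simp: Mh Kh \<Lambda>c a(2))
  have "M * Xf * \<Lambda>f + K * Xf = 0\<^sub>m n (n - p)"
    unfolding \<Lambda>f using eig colf by (intro pencil_eigenvector_matrix[OF cM cK cXf]) auto
  then have eqf: "(M + \<Delta>M) * Xf * \<Lambda>f + (K + \<Delta>K) * Xf = 0\<^sub>m n (n - p)"
    unfolding \<Delta>M' \<Delta>K' using cY
    by (intro update_keeps_pair[OF cM cK cXf cW _ _ Wf]) auto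

  have rankc: "vec_space.rank n Xc = p"
    using rank_mat_of_cols_basis_family[OF basis, of "[0..<p]"] p by (simp add: Xc subset_iff)
  have rankf: "vec_space.rank n Xf = n - p"
    using rank_mat_of_cols_basis_family[OF basis, of "[p..<n]"] p by (simp add: Xf subset_iff)
  have pc: "deflating_pair n (M + \<Delta>M) (K + \<Delta>K) p (Xc, \<Lambda>a)"
    using cXc rankc eqc p by (simp add: deflating_pair_def a(2))
  have pf: "deflating_pair n (M + \<Delta>M) (K + \<Delta>K) (n - p) (Xf, \<Lambda>f)"
    using cXf rankf eqf by (simp add: deflating_pair_def \<Lambda>f)

  have "hcat_mat Xc Xf = mat_of_cols n (map x [0..<n])"
  proof -
    have "cols Xc = map x [0..<p]" "cols Xf = map x [p..<n]"
      unfolding Xc Xf using xc p by (auto intro!: cols_mat_of_cols)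
    moreover have "[0..<n] = [0..<p] @ [p..<n]" using p upt_add_eq_append[of 0 p "n - p"] by simp
    ultimately show ?thesis using cXc by (simp add: hcat_mat_def)
  qed
  moreover have "invertible_mat (mat_of_cols n (map x [0..<n]))"
    using rank_mat_of_cols_basis_family[OF basis, of "[0..<n]"]
    by (intro full_rank_invertible[of _ n]) (simp_all add: subset_iff carrier_matI)
  ultimately have compl: "complementary (Xc, \<Lambda>a) (Xf, \<Lambda>f)" by (simp add: complementary_def)

  have psd: "pos_semidef_mat n \<Delta>M" if "\<forall>i<p. 0 \<le> mat_diag p d $$ (i, i)"
    unfolding \<Delta>M'
  proof (rule pos_semidef_congruence[OF cY])
    fix i assume i: "i < p"
    have "0 \<le> d i" using that i by (simp add: mat_diag_def)
    moreover have "0 \<le> h i"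
    proof -
      obtain r where "a i = complex_of_real r" using a(1)[OF i] by (auto elim: Reals_cases)
      then have "h i = complex_of_real (inverse (r * r + 1))" by (simp add: h_def)
      moreover have "0 \<le> inverse (r * r + 1)" by simp
      ultimately show ?thesis by (simp only: less_eq_complex_def) simp
    qed
    ultimately show "0 \<le> m i" by (simp add: m_def)
  qed
  show ?thesis
    unfolding Let_def D
    using hermitian_congruence[OF cY m_real] hermitian_congruence[OF cY k_real]
      pc pf compl psd pos_def_add_pos_semidef[OF M psd]
    by (simp add: \<Delta>M' \<Delta>K')
qed

end
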